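(* No exact $5$-leaf power contains an induced square-chain of length three. Equivalently, every induced square-chain in an exact $5$-leaf power has length at most two.
   Context: Graphs are finite, simple, undirected. A graph $G$ is an exact $k$-leaf power if there is a tree $T$ whose leaf set is $V(G)$ such that for distinct $u,v\in V(G)$, $uv\in E(G)$ if and only if $\operatorname{dist}_T(u,v)=k$. For $t\ge1$, the ladder $L_t$ is the bipartite graph with parts $\{x_0,\ldots,x_t\}$ and $\{y_0,\ldots,y_t\}$ in which $x_iy_j$ is an edge if and only if $|i-j|\le1$ (so $L_t\cong P_{t+1}\square K_2$). An induced square-chain of length $t$ in a graph $G$ is an induced subgraph of $G$ isomorphic to $L_t$. *)

theory Defs
  imports "Graph_Theory.Graph_Theory"
begin

text \<open>
  A finite simple undirected graph is a \<^locale>\<open>pair_graph\<close>: a finite, loop-free, symmetric set of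
  pairs over a finite vertex set, an edge \<open>uv\<close> being the two arcs \<open>(u, v)\<close> and \<open>(v, u)\<close>.
\<close>

text \<open>
  The library predicate \<^const>\<open>tree\<close> cannot be used here: it forbids directed cycles, and in a
  symmetric digraph every edge already gives the directed cycle \<open>(u, v), (v, u)\<close> of length two.
  Cycles of length at least three are exactly the cycles of the undirected graph.
\<close>

definition undirected_tree :: "'a pair_pre_digraph \<Rightarrow> bool" where
  "undirected_tree T \<longleftrightarrow>
     pair_graph T \<and> Digraph_Component.connected (with_proj T) \<and>
     \<not> (\<exists>p. pre_digraph.cycle (with_proj T) p \<and> 3 \<le> length p)"

definition leaves :: "'a pair_pre_digraph \<Rightarrow> 'a set" where
  "leaves T = {v \<in> pverts T. out_degree (with_proj T) v = 1}"

definition graph_dist :: "'a pair_pre_digraph \<Rightarrow> 'a \<Rightarrow> 'a \<Rightarrow> ereal" where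
  "graph_dist T u v = wf_digraph.\<mu> (with_proj T) (\<lambda>_. 1) u v"

text \<open>
  The vertices of \<open>T\<close> are the vertices of \<open>G\<close> (tagged \<^const>\<open>Inl\<close>), which are precisely its leaves,
  and internal vertices \<open>Inr n\<close>. Since \<open>T\<close> is finite, labelling the internal vertices by natural
  numbers loses no generality, whatever the size of the type \<^typ>\<open>'a\<close>.
\<close>

definition exact_leaf_power :: "nat \<Rightarrow> 'a pair_pre_digraph \<Rightarrow> bool" where
  "exact_leaf_power k G \<longleftrightarrow>
     pair_graph G \<and>
     (\<exists>T :: ('a + nat) pair_pre_digraph.
        undirected_tree T \<and>
        leaves T = Inl ` pverts G \<and>
        (\<forall>u \<in> pverts G. \<forall>v \<in> pverts G. u \<noteq> v \<longrightarrow>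
           ((u, v) \<in> parcs G \<longleftrightarrow> graph_dist T (Inl u) (Inl v) = ereal (real k))))"

text \<open>\<open>Inl i\<close> is the vertex \<open>x\<^sub>i\<close> and \<open>Inr j\<close> is the vertex \<open>y\<^sub>j\<close>.\<close>

definition ladder :: "nat \<Rightarrow> (nat + nat) pair_pre_digraph" where
  "ladder t =
     (let E = {(i, j). i \<le> t \<and> j \<le> t \<and> \<bar>int i - int j\<bar> \<le> 1} in
      \<lparr> pverts = Inl ` {0..t} \<union> Inr ` {0..t},
        parcs = {(Inl i, Inr j) | i j. (i, j) \<in> E} \<union> {(Inr j, Inl i) | i j. (i, j) \<in> E} \<rparr>)"

definition induced_square_chain :: "'a pair_pre_digraph \<Rightarrow> nat \<Rightarrow> 'a pair_pre_digraph \<Rightarrow> bool" where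
  "induced_square_chain H t G \<longleftrightarrow>
     1 \<le> t \<and> induced_subgraph (with_proj H) (with_proj G) \<and>
     digraph_iso (with_proj (ladder t)) (with_proj H)"

end

theory Submission
  imports Defs "HOL-Library.Sublist"
begin

text \<open>
  Trees enter the argument through the four-point condition: among the three sums
  \<open>d a b + d c e\<close>, \<open>d a c + d b e\<close>, \<open>d a e + d b c\<close> of distances between four vertices, the two
  largest are equal.

  For the distance in a tree this is a statement about common prefixes. Call a walk reduced if it
  never traverses an edge and immediately returns along it. Without cycles of length at least
  three, a closed reduced walk is empty (\<open>reduced_closed_awalk_Nil\<close>), because a shortest closed
  piece of it would be a cycle. Hence two vertices are joined by exactly one reduced walk, and its
  length is their distance. From a root \<open>w\<close>, the reduced walks to \<open>x\<close> and \<open>y\<close> share a prefix and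
  then separate for good, and the two remainders form the reduced walk between \<open>x\<close> and \<open>y\<close>. So
  \<open>d x y\<close> is \<open>d w x + d w y\<close> minus twice the length of the common prefix
  (\<open>tree_dist_via_root\<close>). The length of the common prefix is an ultrametric similarity, and with
  \<open>w\<close> chosen as one of the four vertices this is precisely the four-point condition
  (\<open>tree_dist_four_point\<close>).

  Now let \<open>x\<^sub>0, \<dots>, x\<^sub>3, y\<^sub>0, \<dots>, y\<^sub>3\<close> span a ladder whose edges are the pairs \<open>x\<^sub>i y\<^sub>j\<close> at distance \<open>k\<close>,
  and put \<open>a\<^sub>i = d x\<^sub>i x\<^sub>i\<^sub>+\<^sub>1\<close>, \<open>b\<^sub>i = d y\<^sub>i y\<^sub>i\<^sub>+\<^sub>1\<close>. A square of the ladder gives two sums equal to \<open>2k\<close>, so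
  \<open>a\<^sub>i + b\<^sub>i \<le> 2k\<close>. The four vertices \<open>x\<^sub>i, x\<^sub>i\<^sub>+\<^sub>1, y\<^sub>i\<^sub>+\<^sub>1, y\<^sub>i\<^sub>+\<^sub>2\<close> give one sum equal to \<open>2k\<close> and one
  different from it, so \<open>a\<^sub>i + b\<^sub>i\<^sub>+\<^sub>1 \<ge> 2k\<close>, and symmetrically \<open>a\<^sub>i\<^sub>+\<^sub>1 + b\<^sub>i \<ge> 2k\<close>. Three consecutive
  squares force equality everywhere, and then the non-adjacent pairs at index distance two are at
  distance less than \<open>k\<close>. Feeding this back into the four-point condition yields
  \<open>d x\<^sub>0 y\<^sub>3 = k\<close>, although \<open>x\<^sub>0 y\<^sub>3\<close> is not an edge (\<open>no_ladder_in_four_point_metric\<close>).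
\<close>

section \<open>Reduced arc sequences and common prefixes\<close>

definition reduced :: "('a \<times> 'a) list \<Rightarrow> bool" where
  "reduced p \<longleftrightarrow> successively (\<lambda>e f. f \<noteq> prod.swap e) p"

lemma reduced_Nil [simp]: "reduced []"
  by (simp add: reduced_def)

lemma reduced_append_iff:
  "reduced (p @ q) \<longleftrightarrow>
     reduced p \<and> reduced q \<and> (p = [] \<or> q = [] \<or> hd q \<noteq> prod.swap (last p))"
  by (auto simp: reduced_def successively_append_iff)

lemma reduced_Cons_imp: "reduced (e # p) \<Longrightarrow> reduced p"
  by (cases p) (auto simp: reduced_def)

lemma rev_path_conv_rev: "rev_path p = rev (map prod.swap p)"
  by (induction p) (auto simp: prod.swap_def)

lemma length_rev_path [simp]: "length (rev_path p) = length p"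
  by (simp add: rev_path_conv_rev)

lemma reduced_rev_path [simp]: "reduced (rev_path p) \<longleftrightarrow> reduced p"
proof -
  have "(\<lambda>e f. prod.swap e \<noteq> prod.swap (prod.swap f)) = (\<lambda>e f :: 'a \<times> 'a. f \<noteq> prod.swap e)"
    by (auto simp: fun_eq_iff)
  then show ?thesis
    unfolding reduced_def rev_path_conv_rev successively_rev successively_map by (simp only:)
qed

lemma not_reduced_decomp:
  assumes "\<not> reduced p"
  obtains q e r where "p = q @ e # prod.swap e # r"
proof -
  have "\<exists>q e r. p = q @ e # prod.swap e # r"
    using assms
  proof (induction p)
    case (Cons e p)
    show ?case
    proof (cases "reduced p")
      case True
      with Cons.prems obtain r where "p = prod.swap e # r"
        by (cases p) (auto simp: reduced_def)
      then show ?thesis by (metis append_Nil)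
    next
      case False
      with Cons.IH show ?thesis by (metis append_Cons)
    qed
  qed simp
  with that show thesis by blast
qed

lemma strip_common_prefix:
  obtains p' q' where
    "p = longest_common_prefix p q @ p'" "q = longest_common_prefix p q @ q'"
    "p' = [] \<or> q' = [] \<or> hd p' \<noteq> hd q'"
proof -
  have "\<exists>p' q'. p = longest_common_prefix p q @ p' \<and> q = longest_common_prefix p q @ q' \<and>
          (p' = [] \<or> q' = [] \<or> hd p' \<noteq> hd q')"
    by (induction p q rule: longest_common_prefix.induct) auto
  with that show thesis by blast
qed

text \<open>
  Both common prefixes are prefixes of \<open>q\<close>, so they are comparable, and the shorter one is a
  prefix of \<open>p\<close> and of \<open>r\<close> as well.
\<close>

lemma length_longest_common_prefix_ultrametric:
  "min (length (longest_common_prefix p q)) (length (longest_common_prefix q r))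
     \<le> length (longest_common_prefix p r)"
proof -
  let ?a = "longest_common_prefix p q" and ?b = "longest_common_prefix q r"
  have a: "prefix ?a p" "prefix ?a q" and b: "prefix ?b q" "prefix ?b r"
    by (simp_all add: longest_common_prefix_prefix1 longest_common_prefix_prefix2)
  from a(2) b(1) consider "prefix ?a ?b" | "prefix ?b ?a"
    using prefix_same_cases by blast
  then show ?thesis
  proof cases
    case 1
    with a b have "prefix ?a (longest_common_prefix p r)"
      by (meson longest_common_prefix_max_prefix prefix_order.trans)
    then show ?thesis by (simp add: min.coboundedI1 prefix_length_le)
  next
    case 2
    with a b have "prefix ?b (longest_common_prefix p r)"
      by (meson longest_common_prefix_max_prefix prefix_order.trans)
    then show ?thesis by (simp add: min.coboundedI2 prefix_length_le)
  qed
qed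

section \<open>Distances in a tree\<close>

locale undirected_tree_graph = pair_graph +
  assumes undirected_tree: "undirected_tree G"
begin

lemma cycle_length_less_3: "cycle p \<Longrightarrow> length p < 3"
  using undirected_tree by (auto simp: undirected_tree_def not_le[symmetric])

lemma awalk_exists:
  assumes "u \<in> pverts G" "v \<in> pverts G"
  obtains p where "awalk u p v"
proof -
  have "Digraph_Component.connected (with_proj G)"
    using undirected_tree by (simp add: undirected_tree_def)
  then have "u \<rightarrow>\<^sup>*\<^bsub>with_proj (mk_symmetric (with_proj G))\<^esub> v"
    using assms by (auto simp: connected_def strongly_connected_def)
  then have "u \<rightarrow>\<^sup>*\<^bsub>with_proj G\<^esub> v"
    using reachable_mk_symmetric_eq[OF sym_arcs] by simp
  with that show thesis by (auto simp: reachable_awalk)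
qed

text \<open>
  After its first arc the walk either visits no vertex twice, in which case it is a cycle and
  hence has length at most two, so that it is a loop or goes back and forth along one edge; or it
  contains a shorter closed walk, to which induction applies.
\<close>

lemma reduced_closed_awalk_Nil:
  assumes "awalk u p u" "reduced p"
  shows "p = []"
  using assms
proof (induction p arbitrary: u rule: length_induct)
  case (1 p)
  show ?case
  proof (cases p)
    case (Cons e p')
    with 1 have walk: "e \<in> parcs G" "fst e = u" "awalk (snd e) p' u"
      by (auto simp: awalk_Cons_iff)
    show ?thesis
    proof (cases "distinct (awalk_verts (snd e) p')")
      case True
      then have "cycle p"
        using 1(2) Cons unfolding cycle_def by auto
      then have "length p < 3" by (rule cycle_length_less_3)
      with Cons consider "p' = []" | f where "p' = [f]"
        by (cases p'; cases "tl p'") auto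
      then have False
      proof cases
        case 1
        with walk show False
          using no_loops' by (cases e) (auto simp: awalk_Nil_iff)
      next
        case 2
        with walk have "f = prod.swap e"
          by (cases e; cases f) (auto simp: awalk_simps)
        with 1(3) Cons 2 show False by (simp add: reduced_def)
      qed
      then show ?thesis ..
    next
      case False
      from awalk_not_distinct_decomp[OF walk(3)] this
      obtain q r s w where "p' = q @ r @ s" "r \<noteq> []" "awalk w r w"
        by auto
      moreover from this 1(3) Cons have "reduced r"
        by (auto dest!: reduced_Cons_imp simp: reduced_append_iff)
      ultimately have "r = []" using 1(1) Cons by auto
      with \<open>r \<noteq> []\<close> show ?thesis by blast
    qed
  qed simp
qed

text \<open>
  The only place where \<open>rev_path p @ q\<close> could backtrack is the junction at \<open>w\<close>, and there it
  would have to run along the first arc of \<open>p\<close> reversed and then along the same arc forwards.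
\<close>

lemma reduced_fork:
  assumes "awalk w p x" "awalk w q y" "reduced p" "reduced q"
    and "p = [] \<or> q = [] \<or> hd p \<noteq> hd q"
  shows "awalk x (rev_path p @ q) y" "reduced (rev_path p @ q)"
proof -
  from assms(1,2) show "awalk x (rev_path p @ q) y"
    using awalk_appendI awalk_rev_path by blast
  have "p \<noteq> [] \<Longrightarrow> prod.swap (last (rev_path p)) = hd p"
    by (cases p) (auto simp: prod.swap_def)
  with assms(3-5) show "reduced (rev_path p @ q)"
    by (auto simp: reduced_append_iff)
qed

text \<open>
  The remainders after the longest common prefix join to a closed reduced walk at \<open>v\<close>.
\<close>

lemma reduced_awalk_unique:
  assumes "awalk u p v" "awalk u q v" "reduced p" "reduced q"
  shows "p = q"
proof -
  obtain p' q' where split: "p = longest_common_prefix p q @ p'" "q = longest_common_prefix p q @ q'"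
    and fork: "p' = [] \<or> q' = [] \<or> hd p' \<noteq> hd q'"
    by (rule strip_common_prefix)
  define c where "c = longest_common_prefix p q"
  have pq: "p = c @ p'" "q = c @ q'" using split by (simp_all add: c_def)
  from assms pq obtain w where "awalk w p' v" "awalk w q' v"
    by (metis awalk_append_iff)
  moreover have "reduced p'" "reduced q'"
    using assms pq by (auto simp: reduced_append_iff)
  ultimately have "rev_path p' @ q' = []"
    using fork by (intro reduced_closed_awalk_Nil[of v] reduced_fork)
  then show ?thesis using pq by simp
qed

text \<open>
  Cutting out a back-and-forth step shortens a walk by two arcs and keeps its endpoints. By
  uniqueness, the reduced walk between two vertices is therefore a shortest one.
\<close>

lemma awalk_reduce:
  assumes "awalk u p v"
  obtains q where "awalk u q v" "reduced q" "length q \<le> length p"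
proof -
  have "\<exists>q. awalk u q v \<and> reduced q \<and> length q \<le> length p"
    using assms
  proof (induction p rule: length_induct)
    case (1 p)
    show ?case
    proof (cases "reduced p")
      case False
      then obtain q e r where p: "p = q @ e # prod.swap e # r" by (rule not_reduced_decomp)
      with 1(2) have "awalk u (q @ r) v"
        by (auto simp: awalk_simps intro: awalk_appendI)
      moreover have "length (q @ r) < length p" using p by simp
      ultimately show ?thesis using 1(1) by (meson le_trans less_imp_le)
    qed (use 1 in auto)
  qed
  with that show thesis by blast
qed

definition reduced_walk :: "'a \<Rightarrow> 'a \<Rightarrow> ('a \<times> 'a) list" where
  "reduced_walk u v = (THE p. awalk u p v \<and> reduced p)"

definition tree_dist :: "'a \<Rightarrow> 'a \<Rightarrow> nat" where
  "tree_dist u v = length (reduced_walk u v)"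

lemma reduced_walk_eqI: "awalk u p v \<Longrightarrow> reduced p \<Longrightarrow> reduced_walk u v = p"
  unfolding reduced_walk_def using reduced_awalk_unique by blast

lemma tree_dist_eqI: "awalk u p v \<Longrightarrow> reduced p \<Longrightarrow> tree_dist u v = length p"
  by (simp add: tree_dist_def reduced_walk_eqI)

lemma
  assumes "u \<in> pverts G" "v \<in> pverts G"
  shows awalk_reduced_walk: "awalk u (reduced_walk u v) v"
    and reduced_reduced_walk: "reduced (reduced_walk u v)"
proof -
  obtain p where "awalk u p v" "reduced p"
    using awalk_exists[OF assms] awalk_reduce by metis
  then show "awalk u (reduced_walk u v) v" "reduced (reduced_walk u v)"
    by (simp_all add: reduced_walk_eqI)
qed

lemma graph_dist_eq_tree_dist:
  assumes "u \<in> pverts G" "v \<in> pverts G"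
  shows "graph_dist G u v = ereal (real (tree_dist u v))"
proof -
  have cost: "awalk_cost (\<lambda>_. 1) p = real (length p)" for p :: "('a \<times> 'a) list"
    by (induction p) auto
  have "tree_dist u v \<le> length p" if walk: "awalk u p v" for p
    using awalk_reduce[OF walk] tree_dist_eqI by metis
  then have "\<mu> (\<lambda>_. 1) u v = ereal (real (tree_dist u v))"
    unfolding \<mu>_def using awalk_reduced_walk[OF assms]
    by (intro antisym INF_greatest INF_lower2[of "reduced_walk u v"])
      (auto simp: cost tree_dist_def)
  then show ?thesis by (simp add: graph_dist_def)
qed

lemma tree_dist_commute:
  assumes "u \<in> pverts G" "v \<in> pverts G"
  shows "tree_dist u v = tree_dist v u"
  using awalk_reduced_walk[OF assms] reduced_reduced_walk[OF assms]
    tree_dist_eqI[of v "rev_path (reduced_walk u v)" u]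
  by (simp add: tree_dist_def)

text \<open>
  The length of the common prefix is the Gromov product of \<open>x\<close> and \<open>y\<close> with respect to \<open>w\<close>: the
  depth at which the branches to \<open>x\<close> and \<open>y\<close> separate in the tree rooted at \<open>w\<close>.
\<close>

lemma tree_dist_via_root:
  assumes "w \<in> pverts G" "x \<in> pverts G" "y \<in> pverts G"
  shows "tree_dist x y + 2 * length (longest_common_prefix (reduced_walk w x) (reduced_walk w y))
           = tree_dist w x + tree_dist w y"
proof -
  let ?p = "reduced_walk w x" and ?q = "reduced_walk w y"
  define c where "c = longest_common_prefix ?p ?q"
  obtain p' q' where pq: "?p = c @ p'" "?q = c @ q'"
    and fork: "p' = [] \<or> q' = [] \<or> hd p' \<noteq> hd q'"
    unfolding c_def by (rule strip_common_prefix)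
  have walk: "awalk w (c @ p') x" "awalk w (c @ q') y" "reduced (c @ p')" "reduced (c @ q')"
    using assms pq by (metis awalk_reduced_walk reduced_reduced_walk)+
  then obtain b where b: "awalk b p' x" "awalk b q' y"
    by (metis awalk_append_iff)
  have "reduced p'" "reduced q'"
    using walk by (auto simp: reduced_append_iff)
  then have "tree_dist x y = length (rev_path p' @ q')"
    using b fork by (intro tree_dist_eqI reduced_fork)
  then show ?thesis
    unfolding c_def[symmetric] unfolding tree_dist_def[of w] pq by simp
qed

text \<open>
  Rooting the tree at \<open>a\<close> turns the claim into the ultrametric inequality for the depths of
  the branching points of \<open>b\<close>, \<open>c\<close>, \<open>d\<close>. Since the four vertices may be permuted, the bound says
  that the two largest of the three sums are equal.
\<close>

theorem tree_dist_four_point: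
  assumes "a \<in> pverts G" "b \<in> pverts G" "c \<in> pverts G" "d \<in> pverts G"
  shows "tree_dist a b + tree_dist c d
           \<le> max (tree_dist a c + tree_dist b d) (tree_dist a d + tree_dist b c)"
proof -
  let ?l = "\<lambda>x y. length (longest_common_prefix (reduced_walk a x) (reduced_walk a y))"
  have root: "tree_dist x y + 2 * ?l x y = tree_dist a x + tree_dist a y"
    if "x \<in> {b, c, d}" "y \<in> {b, c, d}" for x y
    using tree_dist_via_root that assms by auto
  have comm: "longest_common_prefix p q = longest_common_prefix q p" for p q :: "('a \<times> 'a) list"
    by (induction p q rule: longest_common_prefix.induct) auto
  have "min (?l c b) (?l b d) \<le> ?l c d"
    by (rule length_longest_common_prefix_ultrametric)
  moreover have "?l c b = ?l b c"
    by (simp add: comm)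
  ultimately show ?thesis
    using root[of b c] root[of b d] root[of c d] by (simp add: max_def min_def split: if_splits)
qed

end

section \<open>Ladders\<close>

lemma no_ladder_in_four_point_metric:
  fixes d :: "'v \<Rightarrow> 'v \<Rightarrow> nat" and x y :: "nat \<Rightarrow> 'v"
  assumes sym: "\<And>u v. u \<in> V \<Longrightarrow> v \<in> V \<Longrightarrow> d u v = d v u"
    and four_point: "\<And>a b c e. a \<in> V \<Longrightarrow> b \<in> V \<Longrightarrow> c \<in> V \<Longrightarrow> e \<in> V \<Longrightarrow>
           d a b + d c e \<le> max (d a c + d b e) (d a e + d b c)"
    and V: "\<And>i. i \<le> 3 \<Longrightarrow> x i \<in> V" "\<And>j. j \<le> 3 \<Longrightarrow> y j \<in> V"
    and ladder: "\<And>i j. i \<le> 3 \<Longrightarrow> j \<le> 3 \<Longrightarrow> d (x i) (y j) = k \<longleftrightarrow> \<bar>int i - int j\<bar> \<le> 1"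
  shows False
proof -
  \<comment> \<open>\<open>P i i' j j'\<close> is the sum that pairs the two \<open>x\<close>-vertices and the two \<open>y\<close>-vertices;
    the other two sums pair each \<open>x\<close> with a \<open>y\<close>.\<close>
  define P where "P i i' j j' = d (x i) (x i') + d (y j) (y j')" for i i' j j'
  have four_point_xy:
    "P i i' j j' \<le> max (d (x i) (y j) + d (x i') (y j')) (d (x i) (y j') + d (x i') (y j))"
    "d (x i) (y j) + d (x i') (y j') \<le> max (P i i' j j') (d (x i) (y j') + d (x i') (y j))"
    "d (x i) (y j') + d (x i') (y j) \<le> max (P i i' j j') (d (x i) (y j) + d (x i') (y j'))"
    if "i \<le> 3" "i' \<le> 3" "j \<le> 3" "j' \<le> 3" for i i' j j'
    using four_point[of "x i" "x i'" "y j" "y j'"] four_point[of "x i" "y j" "x i'" "y j'"]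
      four_point[of "x i" "y j'" "x i'" "y j"]
      sym[of "x i'" "y j"] sym[of "x i'" "y j'"] sym[of "y j'" "y j"] that V
    by (simp_all add: P_def)
  have edge: "d (x i) (y j) = k" if "i \<le> 3" "j \<le> 3" "\<bar>int i - int j\<bar> \<le> 1" for i j
    using ladder that by blast
  have nonedge: "d (x i) (y j) \<noteq> k" if "i \<le> 3" "j \<le> 3" "\<bar>int i - int j\<bar> > 1" for i j
    using ladder[of i j] that by auto
  define a where "a i = d (x i) (x (Suc i))" for i
  define b where "b i = d (y i) (y (Suc i))" for i
  have square: "a i + b i \<le> 2 * k" if "i \<le> 2" for i
    using four_point_xy(1)[of i "Suc i" i "Suc i"] edge[of i i] edge[of "Suc i" "Suc i"]
      edge[of i "Suc i"] edge[of "Suc i" i] that by (simp add: a_def b_def P_def)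
  \<comment> \<open>Three edges and one non-edge \<open>x\<^sub>i y\<^sub>j'\<close>: the two mixed sums are \<open>2k\<close> and
    \<open>k + d x\<^sub>i y\<^sub>j' \<noteq> 2k\<close>, so \<open>P\<close> equals the larger of them.\<close>
  have corner:
    "2 * k \<le> P i i' j j'" "P i i' j j' \<le> 2 * k \<Longrightarrow> d (x i) (y j') < k"
    if "d (x i) (y j) = k" "d (x i') (y j') = k" "d (x i') (y j) = k" "d (x i) (y j') \<noteq> k"
      and "i \<le> 3" "i' \<le> 3" "j \<le> 3" "j' \<le> 3" for i i' j j'
    using four_point_xy[of i i' j j'] that by linarith+
  have x_swap: "P (Suc (Suc i)) (Suc i) (Suc i) i = a (Suc i) + b i" if "i \<le> 1" for i
    using sym that V by (simp add: P_def a_def b_def)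
  have P_ab: "P i (Suc i) j (Suc j) = a i + b j" for i j
    by (simp add: P_def a_def b_def)
  have up: "2 * k \<le> a i + b (Suc i)" "a i + b (Suc i) \<le> 2 * k \<Longrightarrow> d (x i) (y (Suc (Suc i))) < k"
    if "i \<le> 1" for i
    using corner[of i "Suc i" "Suc i" "Suc (Suc i)"] edge nonedge that
    by (simp_all add: P_ab)
  have down: "2 * k \<le> a (Suc i) + b i" "a (Suc i) + b i \<le> 2 * k \<Longrightarrow> d (x (Suc (Suc i))) (y i) < k"
    if "i \<le> 1" for i
    using corner[of "Suc (Suc i)" "Suc i" "Suc i" i] edge nonedge that
    by (simp_all add: x_swap)
  \<comment> \<open>The sum \<open>a i + b i + a (i + 1) + b (i + 1)\<close> is at most \<open>4k\<close> by two squares and at least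
    \<open>4k\<close> by two corners, so all four bounds are equalities.\<close>
  have tight: "a 0 + b 1 = 2 * k" "a 1 + b 2 = 2 * k" "a 1 + b 0 = 2 * k" "a 2 + b 1 = 2 * k"
      "a 0 = a 1"
    using square[of 0] square[of 1] square[of 2] up(1)[of 0] up(1)[of 1] down(1)[of 0] down(1)[of 1]
    by (simp_all add: numeral_2_eq_2)
  have below: "d (x 0) (y 2) < k" "d (x 1) (y 3) < k" "d (x 2) (y 0) < k" "d (x 3) (y 1) < k"
    using up(2)[of 0] up(2)[of 1] down(2)[of 0] down(2)[of 1] tight
    by (simp_all add: numeral_2_eq_2 numeral_3_eq_3)
  \<comment> \<open>The \<open>y\<^sub>0 y\<^sub>3\<close> distance: here \<open>x\<^sub>1 y\<^sub>0\<close> and \<open>x\<^sub>2 y\<^sub>3\<close> are edges, while \<open>x\<^sub>1 y\<^sub>3\<close> and \<open>x\<^sub>2 y\<^sub>0\<close> are shorter.\<close>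
  have "P 1 2 0 3 = 2 * k"
    using four_point_xy[of 1 2 0 3] edge[of 1 0] edge[of 2 3] below by simp
  \<comment> \<open>Replacing \<open>x\<^sub>1 x\<^sub>2\<close> by \<open>x\<^sub>0 x\<^sub>1\<close> changes nothing, since \<open>a\<^sub>0 = a\<^sub>1\<close>. Now the sum through
    \<open>x\<^sub>1 y\<^sub>3\<close> is below \<open>2k\<close>, so the sum through \<open>x\<^sub>0 y\<^sub>3\<close> must equal \<open>2k\<close>.\<close>
  then have "P 0 1 0 3 = 2 * k"
    using tight by (simp add: P_def a_def numeral_2_eq_2)
  then have "d (x 0) (y 3) = k"
    using four_point_xy[of 0 1 0 3] edge[of 0 0] edge[of 1 0] below by simp
  with nonedge[of 0 3] show False by simp
qed

lemma induced_square_chainE: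
  fixes G :: "'a pair_pre_digraph"
  assumes "induced_square_chain H t G"
  obtains x y :: "nat \<Rightarrow> 'a" where
    "\<forall>i\<le>t. x i \<in> pverts G" "\<forall>j\<le>t. y j \<in> pverts G"
    "\<forall>i\<le>t. \<forall>j\<le>t. x i \<noteq> y j"
    "\<forall>i\<le>t. \<forall>j\<le>t. (x i, y j) \<in> parcs G \<longleftrightarrow> \<bar>int i - int j\<bar> \<le> 1"
proof -
  let ?L = "with_proj (ladder t)"
  have induced: "pverts H \<subseteq> pverts G"
      "parcs H = {e \<in> parcs G. fst e \<in> pverts H \<and> snd e \<in> pverts H}"
    using assms by (auto simp: induced_square_chain_def induced_subgraph_def subgraph_def)
  obtain f where iso: "pre_digraph.digraph_isomorphism ?L f" and H: "with_proj H = app_iso f ?L"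
    using assms by (auto simp: induced_square_chain_def digraph_iso_def)
  define g where "g = iso_verts f"
  have verts_L: "pverts (ladder t) = Inl ` {0..t} \<union> Inr ` {0..t}"
    by (simp add: ladder_def Let_def)
  have verts_H: "pverts H = g ` pverts (ladder t)"
    using arg_cong[OF H, of verts] by (simp add: g_def)
  have inj: "inj_on g (pverts (ladder t))"
    using pre_digraph.digraph_isomorphism_inj_on_verts[OF iso] by (simp add: g_def)
  \<comment> \<open>The isomorphism may act freely on arcs, but arcs of \<open>H\<close> are pairs of vertices, which
    determines their images.\<close>
  have ends: "iso_arcs f e = (g (fst e), g (snd e))" if "e \<in> parcs (ladder t)" for e
    using pre_digraph.iso_verts_tail[OF iso, of e] pre_digraph.iso_verts_head[OF iso, of e] that
      arg_cong[OF H, of tail] arg_cong[OF H, of head]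
    by (simp add: g_def prod_eq_iff)
  have arcs_H: "parcs H = (\<lambda>e. (g (fst e), g (snd e))) ` parcs (ladder t)"
    using arg_cong[OF H, of arcs] ends by simp
  show thesis
  proof (rule that[of "\<lambda>i. g (Inl i)" "\<lambda>j. g (Inr j)"]; intro allI impI)
    fix i j :: nat
    assume ij: "i \<le> t" "j \<le> t"
    then have vs: "Inl i \<in> pverts (ladder t)" "Inr j \<in> pverts (ladder t)"
      by (auto simp: verts_L)
    then show "g (Inl i) \<noteq> g (Inr j)"
      using inj_onD[OF inj, of "Inl i" "Inr j"] by blast
    have "(g (Inl i), g (Inr j)) \<in> parcs G \<longleftrightarrow> (g (Inl i), g (Inr j)) \<in> parcs H"
      using vs verts_H induced by auto
    also have "\<dots> \<longleftrightarrow> (Inl i, Inr j) \<in> parcs (ladder t)"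
    proof
      assume "(g (Inl i), g (Inr j)) \<in> parcs H"
      then obtain e where e: "e \<in> parcs (ladder t)" "g (fst e) = g (Inl i)" "g (snd e) = g (Inr j)"
        by (auto simp: arcs_H)
      moreover from e(1) have "fst e \<in> pverts (ladder t)" "snd e \<in> pverts (ladder t)"
        by (auto simp: ladder_def Let_def)
      ultimately have "e = (Inl i, Inr j)"
        using vs inj_onD[OF inj] by (metis prod.collapse)
      with e(1) show "(Inl i, Inr j) \<in> parcs (ladder t)" by simp
    qed (force simp: arcs_H)
    also have "\<dots> \<longleftrightarrow> \<bar>int i - int j\<bar> \<le> 1"
      using ij by (auto simp: ladder_def Let_def)
    finally show "(g (Inl i), g (Inr j)) \<in> parcs G \<longleftrightarrow> \<bar>int i - int j\<bar> \<le> 1" .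
  qed (use verts_L verts_H induced in auto)
qed

text \<open>
  A longer chain contains the first four vertices of each side, which already span a ladder with
  three squares.
\<close>

theorem exact_leaf_power_square_chain_le_2:
  assumes "exact_leaf_power k G" "induced_square_chain H t G"
  shows "t \<le> 2"
proof (rule ccontr)
  assume "\<not> t \<le> 2"
  then have t: "3 \<le> t" by simp
  obtain T :: "('a + nat) pair_pre_digraph" where tree: "undirected_tree T"
    and leaves: "leaves T = Inl ` pverts G"
    and power: "\<And>u v. u \<in> pverts G \<Longrightarrow> v \<in> pverts G \<Longrightarrow> u \<noteq> v \<Longrightarrow>
                  (u, v) \<in> parcs G \<longleftrightarrow> graph_dist T (Inl u) (Inl v) = ereal (real k)"
    using assms(1) unfolding exact_leaf_power_def by blast
  interpret pair_graph T
    using tree by (simp add: undirected_tree_def)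
  interpret undirected_tree_graph T
    using tree by unfold_locales
  have verts: "Inl u \<in> pverts T" if "u \<in> pverts G" for u
    using leaves that by (auto simp: leaves_def)
  obtain x y where xy:
    "\<forall>i\<le>t. x i \<in> pverts G" "\<forall>j\<le>t. y j \<in> pverts G"
    "\<forall>i\<le>t. \<forall>j\<le>t. x i \<noteq> y j"
    "\<forall>i\<le>t. \<forall>j\<le>t. (x i, y j) \<in> parcs G \<longleftrightarrow> \<bar>int i - int j\<bar> \<le> 1"
    by (rule induced_square_chainE[OF assms(2)])
  show False
  proof (rule no_ladder_in_four_point_metric[of "pverts T" tree_dist "\<lambda>i. Inl (x i)" "\<lambda>j. Inl (y j)" k])
    fix i j :: nat
    assume "i \<le> 3" "j \<le> 3"
    then have "i \<le> t" "j \<le> t" using t by auto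
    then show "tree_dist (Inl (x i)) (Inl (y j)) = k \<longleftrightarrow> \<bar>int i - int j\<bar> \<le> 1"
      using xy power[of "x i" "y j"] by (simp add: graph_dist_eq_tree_dist verts)
  next
    fix i :: nat
    assume "i \<le> 3"
    then show "Inl (x i) \<in> pverts T" "Inl (y i) \<in> pverts T"
      using t xy verts by simp_all
  qed (use tree_dist_commute tree_dist_four_point in blast)+
qed

theorem corollary3p5:
  fixes G :: "'a pair_pre_digraph"
  assumes "exact_leaf_power 5 G"
  shows "\<not> (\<exists>H. induced_square_chain H 3 G) \<and>
         (\<forall>H t. induced_square_chain H t G \<longrightarrow> t \<le> 2)"
  using exact_leaf_power_square_chain_le_2[OF assms] by fastforce

end
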